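(* If $G$ is a connected graph with maximum degree at most $3$ and $G$ is not isomorphic to the 5-cycle $C_5$, then $G$ is proper conflict-free $(\mathrm{degree}+2)$-choosable.
   Context: All graphs are simple, finite and undirected. $d_G(v)$ denotes the degree of $v$ in $G$. Given a graph $G$ and a mapping $f:V(G)\to\mathbb{N}$, an $f$-list assignment of $G$ is a function $L$ that maps each $v\in V(G)$ to a set $L(v)$ of at least $f(v)$ colors. For an $f$-list assignment $L$, a proper conflict-free $L$-coloring of $G$ is a coloring $\phi$ of $V(G)$ such that (i) $\phi(v)\in L(v)$ for every $v\in V(G)$, (ii) $\phi$ is proper, i.e. adjacent vertices receive distinct colors, and (iii) for every non-isolated vertex $v\in V(G)$ there is a color that appears exactly once in the neighborhood of $v$ (i.e. is assigned to exactly one neighbor of $v$). $G$ is proper conflict-free $f$-choosable if for every $f$-list assignment $L$ of $G$ there exists a proper conflict-free $L$-coloring of $G$. For a non-negative integer $k$, $G$ is proper conflict-free $(\mathrm{degree}+k)$-choosable if $G$ is proper conflict-free $f$-choosable for the mapping $f(v)=d_G(v)+k$ for every $v\in V(G)$. *)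

theory Defs
  imports "Graph_Theory.Digraph_Isomorphism"
begin

text \<open>
  Simple finite undirected graphs are represented by the locale \<^locale>\<open>graph\<close>: finite symmetric
  digraphs without loops and parallel arcs, each undirected edge being a pair of opposite arcs.
\<close>

definition neighborhood :: "('a, 'b) pre_digraph \<Rightarrow> 'a \<Rightarrow> 'a set" where
  "neighborhood G v = {u. v \<rightarrow>\<^bsub>G\<^esub> u}"

text \<open>
  The degree of a vertex is its \<^const>\<open>out_degree\<close>; this is the number of neighbours.
\<close>

lemma (in graph) out_degree_eq_card_neighborhood:
  "out_degree G v = card (neighborhood G v)"
proof -
  have "neighborhood G v = head G ` out_arcs G v"
    by (auto simp: neighborhood_def out_arcs_def arcs_ends_conv)
  moreover have "inj_on (head G) (out_arcs G v)"
    by (rule inj_onI) (auto simp: arc_to_ends_def intro: no_multi_arcs)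
  ultimately show ?thesis
    by (simp add: out_degree_def card_image)
qed

definition max_degree :: "('a, 'b) pre_digraph \<Rightarrow> nat" where
  "max_degree G = Max (out_degree G ` verts G)"

definition cycle_graph :: "nat \<Rightarrow> (nat, nat \<times> nat) pre_digraph" where
  "cycle_graph n = \<lparr> verts = {..<n},
     arcs = {(i, j). i < n \<and> j < n \<and> (j = Suc i mod n \<or> i = Suc j mod n)},
     tail = fst, head = snd \<rparr>"

lemma graph_cycle_graph:
  assumes "3 \<le> n"
  shows "graph (cycle_graph n)"
proof
  have "finite {(i, j). i < n \<and> j < n \<and> (j = Suc i mod n \<or> i = Suc j mod n)}"
    by (rule finite_subset[of _ "{..<n} \<times> {..<n}"]) auto
  then show "finite (arcs (cycle_graph n))"
    by (simp add: cycle_graph_def)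
next
  fix e assume "e \<in> arcs (cycle_graph n)"
  then show "tail (cycle_graph n) e \<noteq> head (cycle_graph n) e"
    using assms by (auto simp: cycle_graph_def mod_Suc split: if_splits)
qed (use assms in \<open>auto simp: cycle_graph_def arc_to_ends_def symmetric_conv\<close>)

text \<open>
  The disjunct for infinite lists is needed because \<^const>\<open>card\<close> is 0 on infinite sets.
\<close>

definition list_assignment ::
  "('a, 'b) pre_digraph \<Rightarrow> ('a \<Rightarrow> nat) \<Rightarrow> ('a \<Rightarrow> 'c set) \<Rightarrow> bool" where
  "list_assignment G f L \<longleftrightarrow> (\<forall>v \<in> verts G. infinite (L v) \<or> f v \<le> card (L v))"

definition proper_conflict_free_coloring ::
  "('a, 'b) pre_digraph \<Rightarrow> ('a \<Rightarrow> 'c set) \<Rightarrow> ('a \<Rightarrow> 'c) \<Rightarrow> bool" where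
  "proper_conflict_free_coloring G L \<phi> \<longleftrightarrow>
     (\<forall>v \<in> verts G. \<phi> v \<in> L v) \<and>
     (\<forall>u \<in> verts G. \<forall>v \<in> verts G. u \<rightarrow>\<^bsub>G\<^esub> v \<longrightarrow> \<phi> u \<noteq> \<phi> v) \<and>
     (\<forall>v \<in> verts G. neighborhood G v \<noteq> {} \<longrightarrow>
        (\<exists>c. \<exists>!u. u \<in> neighborhood G v \<and> \<phi> u = c))"

text \<open>
  The type of colours is a parameter, so that a theorem with a free type variable here
  covers lists of colours of any kind.
\<close>

definition proper_conflict_free_choosable ::
  "'c itself \<Rightarrow> ('a, 'b) pre_digraph \<Rightarrow> ('a \<Rightarrow> nat) \<Rightarrow> bool" where
  "proper_conflict_free_choosable C G f \<longleftrightarrow>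
     (\<forall>L :: 'a \<Rightarrow> 'c set. list_assignment G f L \<longrightarrow>
        (\<exists>\<phi>. proper_conflict_free_coloring G L \<phi>))"

definition proper_conflict_free_degree_choosable ::
  "'c itself \<Rightarrow> ('a, 'b) pre_digraph \<Rightarrow> nat \<Rightarrow> bool" where
  "proper_conflict_free_degree_choosable C G k \<longleftrightarrow>
     proper_conflict_free_choosable C G (\<lambda>v. out_degree G v + k)"

end

theory Submission
  imports Defs
begin

text \<open>
  Take a minimal counterexample, where a component that is a 5-cycle with all lists of size 4
  is also forbidden; this hypothesis passes to induced subgraphs. Delete a vertex \<open>v\<close> and colour
  the rest. A colour for \<open>v\<close> has to avoid the colours of its neighbours and, for every neighbour
  whose remaining neighbourhood is monochromatic, the colour of that neighbourhood; besides, some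
  colour has to occur exactly once around \<open>v\<close>. A neighbour \<open>x\<close> of \<open>v\<close> has a spare colour
  in its list after the deletion. Hence its colour can be changed (by exchanging it with a
  neighbour's if need be) without losing anything but the uniqueness condition at \<open>x\<close>, which the
  colour of \<open>v\<close> then restores. This settles all cases except that of a vertex \<open>v\<close> on a cycle
  component of length at least 5 with all lists of size 4. From a cycle of length at least 6 delete
  four consecutive vertices: to colour them one has to colour the 4-cycle with one chord from
  lists of sizes 2, 3, 3, 2.
\<close>

section \<open>Colours on a set: unique occurrence and monochromaticity\<close>

definition uniq :: "('a \<Rightarrow> 'c) \<Rightarrow> 'a set \<Rightarrow> bool" where
  "uniq \<phi> A \<longleftrightarrow> (\<exists>u\<in>A. \<forall>w\<in>A. \<phi> w = \<phi> u \<longrightarrow> w = u)"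

text \<open>A set with at most one element, so that it can be joined directly to the other colours
  that a vertex must avoid.\<close>

definition mono_color :: "('a \<Rightarrow> 'c) \<Rightarrow> 'a set \<Rightarrow> 'c set" where
  "mono_color \<phi> A = {d. A \<noteq> {} \<and> (\<forall>u\<in>A. \<phi> u = d)}"

lemma mono_color_empty [simp]: "mono_color \<phi> {} = {}"
  by (simp add: mono_color_def)

lemma mono_color_insert [simp]:
  "mono_color \<phi> (insert x A) = (if \<forall>u\<in>A. \<phi> u = \<phi> x then {\<phi> x} else {})"
  by (auto simp: mono_color_def)

lemma mono_color_sub: "\<exists>d. mono_color \<phi> A \<subseteq> {d}"
  by (cases "A = {}") (auto simp: mono_color_def)

lemma finite_mono_color [simp]: "finite (mono_color \<phi> A)"
  and card_mono_color: "card (mono_color \<phi> A) \<le> 1"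
proof -
  obtain d where "mono_color \<phi> A \<subseteq> {d}"
    using mono_color_sub by (rule exE)
  then have "mono_color \<phi> A = {} \<or> mono_color \<phi> A = {d}"
    by (rule subset_singletonD)
  then show "finite (mono_color \<phi> A)" "card (mono_color \<phi> A) \<le> 1"
    by fastforce+
qed

lemma mono_color_eq_singletonD:
  assumes "mono_color \<phi> A = {d}"
  shows "\<phi> ` A = {d}"
proof -
  have "d \<in> mono_color \<phi> A"
    by (simp add: assms)
  then show ?thesis
    by (auto simp: mono_color_def)
qed

lemma uniq_cong: "(\<And>u. u \<in> A \<Longrightarrow> \<phi> u = \<psi> u) \<Longrightarrow> uniq \<phi> A = uniq \<psi> A"
  by (simp add: uniq_def cong: bex_cong ball_cong)

lemma uniq_singleton [simp]: "uniq \<phi> {u}"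
  by (simp add: uniq_def)

lemma uniq_pair: "\<phi> u \<noteq> \<phi> w \<Longrightarrow> uniq \<phi> {u, w}"
  by (auto simp: uniq_def)

lemma card_le_2_cases:
  assumes "finite A" "card A \<le> 2"
  obtains "A = {}" | u where "A = {u}" | u w where "A = {u, w}" "u \<noteq> w"
proof -
  consider "card A = 0" | "card A = 1" | "card A = 2"
    using assms(2) by linarith
  then show thesis
    using that assms(1) by cases (auto simp: card_1_singleton_iff card_2_iff)
qed

lemma card_2_other:
  assumes "card A = 2" "u \<in> A"
  obtains w where "A = {u, w}" "u \<noteq> w"
  using assms by (auto simp: card_2_iff)

text \<open>If \<open>c\<close> is the colour of some element of \<open>A\<close>, then the other
  element has a different colour, which is unique; otherwise \<open>c\<close> is unique. The bound 2
  is what maximum degree 3 leaves around a neighbour of a deleted vertex.\<close>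

lemma uniq_insert:
  assumes "finite A" "card A \<le> 2" "c \<notin> mono_color \<phi> A" "v \<notin> A"
  shows "uniq (\<phi>(v := c)) (insert v A)"
  using assms(1,2)
proof (cases rule: card_le_2_cases)
  case (2 u)
  then show ?thesis
    using assms by (auto simp: mono_color_def uniq_def)
next
  case (3 u w)
  then have "c \<noteq> \<phi> u \<or> c \<noteq> \<phi> w"
    using assms(3) by (auto simp: mono_color_def)
  then show ?thesis
    using 3 assms(4) by (cases "\<phi> u = c"; cases "\<phi> w = c") (auto simp: uniq_def)
qed auto

lemma uniq_2_mono_color:
  assumes "uniq \<phi> A" "card A = 2"
  shows "mono_color \<phi> A = {}"
  using assms by (auto simp: mono_color_def uniq_def card_2_iff)

text \<open>Three elements with at least two colours split as 2+1 or 1+1+1, so some colour class is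
  a singleton.\<close>

lemma uniq_3:
  assumes "card A = 3" "mono_color \<phi> A = {}"
  shows "uniq \<phi> A"
proof -
  obtain x y z where A: "A = {x, y, z}" "x \<noteq> y" "y \<noteq> z" "x \<noteq> z"
    using assms(1) by (auto simp: card_3_iff)
  have "\<not> (\<forall>u\<in>{y, z}. \<phi> u = \<phi> x)"
    using assms(2) unfolding A(1) mono_color_insert by (metis insert_not_empty)
  then have "\<phi> y \<noteq> \<phi> x \<or> \<phi> z \<noteq> \<phi> x"
    by simp
  then consider "\<phi> z \<noteq> \<phi> x" "\<phi> z \<noteq> \<phi> y" | "\<phi> x \<noteq> \<phi> y" "\<phi> x \<noteq> \<phi> z" | "\<phi> y \<noteq> \<phi> x" "\<phi> y \<noteq> \<phi> z"
    by metis
  then show ?thesis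
  proof cases
    case 1
    then show ?thesis
      by (simp add: uniq_def A(1))
  next
    case 2
    then show ?thesis
      by (simp add: uniq_def A(1))
  next
    case 3
    then show ?thesis
      by (simp add: uniq_def A(1))
  qed
qed

section \<open>Choosing colours from lists\<close>

lemma ex_outside:
  assumes "finite B" "card B < card A"
  shows "\<exists>c\<in>A. c \<notin> B"
  using assms by (meson card_mono linorder_not_less subsetI)

text \<open>The length of a list bounds the number of forbidden colours, whether or not they
  coincide.\<close>

lemma ex_avoiding:
  assumes "length xs < card A"
  obtains c where "c \<in> A" "c \<notin> set xs"
  using ex_outside[of "set xs" A] card_length[of xs] assms by auto

text \<open>The 4-cycle with one chord, whose ends are \<open>b\<close> and \<open>c\<close>, is degree-choosable.\<close>

lemma list_color_diamond:
  assumes "2 \<le> card A" "3 \<le> card B" "3 \<le> card C" "2 \<le> card D"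
  obtains a b c d where "a \<in> A" "b \<in> B" "c \<in> C" "d \<in> D"
    "a \<noteq> b" "a \<noteq> c" "b \<noteq> c" "b \<noteq> d" "c \<noteq> d"
proof -
  \<comment> \<open>Here \<open>xs\<close> covers the colours that \<open>a\<close> and
    \<open>d\<close> take from \<open>B\<close>. The last condition leaves a colour for
    \<open>b\<close> after \<open>c\<close>, which is chosen outside \<open>{a, d}\<close>.\<close>
  obtain a d xs where ad: "a \<in> A" "d \<in> D" "{a, d} \<inter> B \<subseteq> set xs" "length xs + 1 < card B"
  proof (cases "A \<inter> D = {} \<and> card B = 3")
    case True
    have fin: "finite A" "finite D"
      using assms(1,4) by (auto intro: card_ge_0_finite)
    \<comment> \<open>Two disjoint lists of size at least 2 have more than three colours together,
      so one of these lies outside \<open>B\<close> and costs \<open>b\<close> nothing.\<close>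
    obtain e where e: "e \<in> A \<union> D" "e \<notin> B"
    proof -
      have "card (A \<union> D) = card A + card D"
        using fin True by (simp add: card_Un_disjoint)
      then have "card B < card (A \<union> D)"
        using assms True by linarith
      moreover have "finite B"
        using assms(2) by (auto intro: card_ge_0_finite)
      ultimately show thesis
        using ex_outside that by blast
    qed
    obtain a where a: "a \<in> A"
      using ex_avoiding[of "[]" A] assms(1) by auto
    obtain d where d: "d \<in> D"
      using ex_avoiding[of "[]" D] assms(4) by auto
    show thesis
    proof (cases "e \<in> A")
      case eA: True
      show thesis
        using eA d e(2) True by (intro that[of e d "[d]"]) auto
    next
      case False
      then show thesis
        using a e True by (intro that[of a e "[a]"]) auto
    qed
  next
    case False
    \<comment> \<open>Otherwise \<open>a\<close> and \<open>d\<close> can share a colour, or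
      \<open>B\<close> can afford to lose two colours.\<close>
    then consider e where "e \<in> A" "e \<in> D" | "4 \<le> card B"
      using assms(2) by fastforce
    then show thesis
    proof cases
      case (1 e)
      then show thesis
        using assms(2) by (intro that[of e e "[e]"]) auto
    next
      case 2
      obtain a where a: "a \<in> A"
        using ex_avoiding[of "[]" A] assms(1) by auto
      obtain d where d: "d \<in> D"
        using ex_avoiding[of "[]" D] assms(4) by auto
      show thesis
        using a d 2 by (intro that[of a d "[a, d]"]) auto
    qed
  qed
  obtain c where c: "c \<in> C" "c \<notin> set [a, d]"
    by (rule ex_avoiding[of "[a, d]" C]) (use assms(3) in auto)
  obtain b where b: "b \<in> B" "b \<notin> set (c # xs)"
    by (rule ex_avoiding[of "c # xs" B]) (use ad(4) in auto)
  show thesis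
    using ad(1-3) b c by (intro that[of a b c d]) auto
qed

section \<open>Vertex sets with lists and their partial colourings\<close>

locale list_graph =
  fixes E :: "'a \<Rightarrow> 'a \<Rightarrow> bool" and L :: "'a \<Rightarrow> 'c set"
  assumes sym: "E u v \<Longrightarrow> E v u"
    and irrefl: "\<not> E v v"
begin

definition nb :: "'a set \<Rightarrow> 'a \<Rightarrow> 'a set" where
  "nb S v = {u \<in> S. E v u}"

text \<open>The vertices in \<open>T\<close> are exempt from the conflict-free condition.\<close>

definition good :: "'a set \<Rightarrow> 'a set \<Rightarrow> ('a \<Rightarrow> 'c) \<Rightarrow> bool" where
  "good S T \<phi> \<longleftrightarrow> (\<forall>v\<in>S. \<phi> v \<in> L v) \<and> (\<forall>v\<in>S. \<forall>u\<in>nb S v. \<phi> u \<noteq> \<phi> v) \<and>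
     (\<forall>v\<in>S - T. nb S v \<noteq> {} \<longrightarrow> uniq \<phi> (nb S v))"

text \<open>Degrees are taken inside \<open>S\<close>, so the condition is inherited by subsets. It
  forces the lists to be finite, because \<open>card\<close> is 0 on infinite sets.\<close>

definition admissible :: "'a set \<Rightarrow> bool" where
  "admissible S \<longleftrightarrow> finite S \<and> (\<forall>v\<in>S. card (nb S v) \<le> 3 \<and> card (nb S v) + 2 \<le> card (L v))"

lemma E_commute: "E u v \<longleftrightarrow> E v u"
  using sym by blast

lemma nb_sym: "u \<in> nb S v \<Longrightarrow> v \<in> S \<Longrightarrow> v \<in> nb S u"
  by (auto simp: nb_def sym)

lemma nb_subset: "nb S v \<subseteq> S"
  by (auto simp: nb_def)

lemma not_nb_self [simp]: "v \<notin> nb S v"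
  by (auto simp: nb_def irrefl)

lemma nb_insert: "nb (insert v S) w = (if E w v then insert v (nb S w) else nb S w)"
  by (auto simp: nb_def)

lemma nb_Diff: "nb (S - T) v = nb S v - T"
  by (auto simp: nb_def)

lemma finite_nb: "finite S \<Longrightarrow> finite (nb S v)"
  by (auto simp: nb_def)

lemma card_nb_remove: 
  assumes "finite S" "v \<in> S" "x \<in> nb S v"
  shows "card (nb S x) = Suc (card (nb (S - {v}) x))"
  unfolding nb_Diff using assms finite_nb nb_sym by (intro card.remove) blast+

lemma admissible_subset:
  assumes "admissible S" "S' \<subseteq> S"
  shows "admissible S'"
proof -
  have "card (nb S' v) \<le> card (nb S v)" for v
    using assms by (intro card_mono) (auto simp: admissible_def nb_def)
  then show ?thesis
    using assms unfolding admissible_def by (meson finite_subset le_trans add_le_mono1 subsetD)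
qed

text \<open>The old neighbourhoods that change are those of the neighbours of \<open>v\<close>, and
  \<open>uniq_insert\<close> gives each of them a unique colour. It does so whether or not they had
  one before, which is why \<open>T\<close> may be exempt.\<close>

lemma good_extend:
  assumes "finite S" "good S T \<phi>" "v \<notin> S" "T \<subseteq> nb S v"
    and "c \<in> L v" "c \<notin> \<phi> ` nb S v" "nb S v \<noteq> {} \<Longrightarrow> uniq \<phi> (nb S v)"
    and "\<And>x. x \<in> nb S v \<Longrightarrow> card (nb S x) \<le> 2 \<and> c \<notin> mono_color \<phi> (nb S x)"
  shows "good (insert v S) {} (\<phi>(v := c))"
proof -
  have eq: "(\<phi>(v := c)) u = \<phi> u" if "u \<in> S" for u
    using that assms(3) by auto
  have uq: "uniq (\<phi>(v := c)) (nb S w) = uniq \<phi> (nb S w)" for w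
    using eq nb_subset by (intro uniq_cong) blast
  have "uniq (\<phi>(v := c)) (nb (insert v S) w)" 
    if w: "w \<in> insert v S" "nb (insert v S) w \<noteq> {}" for w
  proof (cases "w = v")
    case True
    then show ?thesis
      using w assms(7) uq by (simp add: nb_insert irrefl)
  next
    case False
    then have "w \<in> S"
      using w by simp
    show ?thesis
    proof (cases "E w v")
      case True
      then have "w \<in> nb S v"
        using \<open>w \<in> S\<close> by (simp add: nb_def sym)
      then show ?thesis
        using assms(8)[of w] assms(1,3) True
        by (simp add: nb_insert) (intro uniq_insert, auto simp: finite_nb nb_def)
    next
      case nE: False
      then have "w \<notin> T"
        using assms(4) sym by (auto simp: nb_def)
      then show ?thesis
        using assms(2) w nE \<open>w \<in> S\<close> by (simp add: nb_insert uq good_def)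
    qed
  qed
  moreover have "(\<phi>(v := c)) u \<noteq> (\<phi>(v := c)) w" 
    if "w \<in> insert v S" "u \<in> nb (insert v S) w" for u w
  proof -
    have "E w u" "u \<in> insert v S"
      using that by (auto simp: nb_def)
    then show ?thesis
      using that(1) assms(2,3,6) sym irrefl by (auto simp: good_def nb_def image_iff)
  qed
  ultimately show ?thesis
    using assms(2,5) eq by (auto simp: good_def)
qed

text \<open>Only the neighbours of \<open>x\<close> lose a member of their neighbourhood.\<close>

lemma good_remove:
  assumes "good S {} \<phi>" "x \<in> S"
  shows "good (S - {x}) (nb (S - {x}) x) \<phi>"
proof -
  have "nb (S - {x}) w = nb S w" if "w \<in> S - {x} - nb (S - {x}) x" for w
    using that sym by (auto simp: nb_def)
  then show ?thesis
    using assms unfolding good_def by (auto simp: nb_Diff)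
qed

section \<open>Changing the colour of a vertex\<close>

definition forb :: "'a set \<Rightarrow> ('a \<Rightarrow> 'c) \<Rightarrow> 'a \<Rightarrow> 'c set" where
  "forb S \<phi> v = \<phi> ` nb S v \<union> (\<Union>x\<in>nb S v. mono_color \<phi> (nb S x))"

lemma finite_forb: "finite S \<Longrightarrow> finite (forb S \<phi> v)"
  by (simp add: forb_def finite_nb)

lemma card_UN_mono_color: 
  assumes "finite A"
  shows "card (\<Union>x\<in>A. mono_color \<phi> (f x)) \<le> card A"
proof -
  have "card (\<Union>x\<in>A. mono_color \<phi> (f x)) \<le> (\<Sum>x\<in>A. card (mono_color \<phi> (f x)))"
    using assms by (rule card_UN_le)
  also have "\<dots> \<le> (\<Sum>x\<in>A. 1)"
    by (intro sum_mono card_mono_color)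
  finally show ?thesis
    by simp
qed

lemma card_nb_remove_le:
  assumes "admissible S" "v \<in> S" "x \<in> nb (S - {v}) v"
  shows "card (nb (S - {v}) x) \<le> 2"
proof -
  have x: "x \<in> nb S v"
    using assms(3) by (simp add: nb_Diff)
  then have "x \<in> S"
    by (simp add: nb_def)
  then have "card (nb S x) \<le> 3" "finite S"
    using assms(1) by (simp_all add: admissible_def)
  then show ?thesis
    using card_nb_remove[OF _ assms(2) x] by simp
qed

text \<open>In the application, \<open>S\<close> arises by deleting a neighbour of \<open>x\<close>;
  hence the bounds on degree and list. Either some colour is free for \<open>x\<close>, or the count
  of forbidden colours is tight and \<open>x\<close> takes over the colour of a neighbour. The last
  conclusion serves to separate \<open>x\<close> from vertices that shared its colour.\<close>

lemma recolor:
  assumes ad: "admissible S" and x: "x \<in> S" and g: "good S {} \<phi>"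
    and deg: "card (nb S x) \<le> 2" and list: "card (nb S x) + 3 \<le> card (L x)"
  obtains \<psi> where "good S {x} \<psi>" "\<psi> x \<noteq> \<phi> x"
    "\<And>w. w \<in> S \<Longrightarrow> w \<noteq> x \<Longrightarrow> \<phi> w = \<phi> x \<Longrightarrow> \<psi> w = \<phi> w"
proof -
  define S1 where "S1 = S - {x}"
  have S1: "finite S" "finite S1" "x \<notin> S1" "insert x S1 = S" "nb S1 x = nb S x"
    using ad x by (auto simp: S1_def admissible_def nb_Diff)
  define B where "B = insert (\<phi> x) (forb S1 \<phi> x)"
  have finB: "finite B"
    using S1 by (simp add: B_def finite_forb)
  have g1: "good S1 (nb S1 x) \<phi>"
    using good_remove[OF g x] by (simp add: S1_def)
  show thesis
  proof (cases "\<exists>d\<in>L x. d \<notin> B")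
    case True
    then obtain d where d: "d \<in> L x" "d \<notin> B"
      by auto
    have "good (insert x S1) {} (\<phi>(x := d))"
    proof (rule good_extend[OF S1(2) g1 S1(3) order_refl d(1)])
      show "d \<notin> \<phi> ` nb S1 x"
        using d(2) by (auto simp: B_def forb_def)
      show "nb S1 x \<noteq> {} \<Longrightarrow> uniq \<phi> (nb S1 x)"
        using g x S1 by (simp add: good_def)
      show "card (nb S1 p) \<le> 2 \<and> d \<notin> mono_color \<phi> (nb S1 p)" if "p \<in> nb S1 x" for p
        using that card_nb_remove_le[OF ad x] d(2) by (auto simp: B_def forb_def S1_def)
    qed
    then have "good S {x} (\<phi>(x := d))"
      using S1(4) by (simp add: good_def)
    then show thesis
      using d(2) by (intro that[of "\<phi>(x := d)"]) (auto simp: B_def)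
  next
    case False
    then have sub: "L x \<subseteq> B"
      by auto
    then have cB: "card (nb S x) + 3 \<le> card B"
      using list card_mono[OF finB sub] by linarith
    \<comment> \<open>All the inequalities below are equalities, so the forbidden colours are distinct.\<close>
    have "card (nb S x) = 2"
    proof -
      \<comment> \<open>Each of the k neighbours forbids its own colour and at most one more. So k +
        3 \<le> 2k + 1, and k \<le> 2 forces k = 2.\<close>
      have "card B \<le> 1 + (card (nb S x) + card (nb S x))"
      proof -
        have "card (forb S1 \<phi> x) \<le> card (nb S x) + card (nb S x)"
          unfolding forb_def S1(5)
          by (intro order_trans[OF card_Un_le] add_mono card_image_le card_UN_mono_color)
            (simp_all add: S1 finite_nb)
        then show ?thesis
          using card_insert_le_m1 S1 by (simp add: B_def card_insert_if finite_forb)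
      qed
      then show ?thesis
        using cB deg by linarith
    qed
    then obtain p q where pq: "nb S x = {p, q}" "p \<noteq> q"
      by (auto simp: card_2_iff)
    let ?M = "nb S1 p" and ?N = "nb S1 q"
    have c5: "5 \<le> card B"
      using cB \<open>card (nb S x) = 2\<close> by simp
    have Beq: "B = {\<phi> x, \<phi> p, \<phi> q} \<union> mono_color \<phi> ?M \<union> mono_color \<phi> ?N"
      using pq S1 by (auto simp: B_def forb_def)
    have cMN: "card (mono_color \<phi> ?M) \<le> 1" "card (mono_color \<phi> ?N) \<le> 1"
      by (rule card_mono_color)+
    have "card B \<le> card {\<phi> x, \<phi> p, \<phi> q} + card (mono_color \<phi> ?M) + card (mono_color \<phi> ?N)"
      unfolding Beq by (intro order_trans[OF card_Un_le] add_mono card_Un_le order_refl)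
    moreover have "card {\<phi> x, \<phi> p, \<phi> q} \<le> 3"
      by (simp add: card_insert_if)
    ultimately have "card (mono_color \<phi> ?M) = 1" "card (mono_color \<phi> ?N) = 1"
      using c5 cMN by linarith+
    then obtain \<alpha> \<beta> where \<alpha>: "mono_color \<phi> ?M = {\<alpha>}" and \<beta>: "mono_color \<phi> ?N = {\<beta>}"
      by (auto simp: card_1_singleton_iff)
    have "B = set [\<phi> x, \<phi> p, \<phi> q, \<alpha>, \<beta>]"
      using Beq \<alpha> \<beta> by auto
    then have dist: "distinct [\<phi> x, \<phi> p, \<phi> q, \<alpha>, \<beta>]"
      using c5 card_length[of "[\<phi> x, \<phi> p, \<phi> q, \<alpha>, \<beta>]"] by (intro card_distinct) simp
    \<comment> \<open>The list of \<open>x\<close> consists of exactly the five forbidden colours;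
      in particular it contains \<phi> p.\<close>
    have LxB: "L x = B"
    proof (rule card_subset_eq[OF finB sub])
      have "card B \<le> 5"
        using card_length[of "[\<phi> x, \<phi> p, \<phi> q, \<alpha>, \<beta>]"] \<open>B = set _\<close> by simp
      then show "card (L x) = card B"
        using list \<open>card (nb S x) = 2\<close> card_mono[OF finB sub] by linarith
    qed
    have \<alpha>M: "\<phi> ` ?M = {\<alpha>}" and \<beta>N: "\<phi> ` ?N = {\<beta>}"
      by (rule mono_color_eq_singletonD, fact)+
    have xp: "E x p" "E p x" "E x q" "E q x" "p \<in> S" "q \<in> S" "p \<noteq> x" "q \<noteq> x"
      using pq sym irrefl by (auto simp: nb_def)
    \<comment> \<open>An edge would put \<open>q\<close> among the other neighbours of
      \<open>p\<close>, which all have colour \<alpha>.\<close>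
    have npq: "\<not> E p q" "\<not> E q p"
    proof -
      have "\<phi> u = \<alpha>" if "E p u" "u \<in> S1" for u
        using that \<alpha>M by (auto simp: nb_def)
      then show "\<not> E p q"
        using dist xp by (auto simp: S1_def)
      then show "\<not> E q p"
        using sym by blast
    qed
    have nx: "E x w \<longleftrightarrow> w = p \<or> w = q" if "w \<in> S" for w
      using pq that by (auto simp: nb_def)
    \<comment> \<open>Instead \<open>x\<close> takes the colour of \<open>p\<close>, and \<open>p\<close> a new colour.\<close>
    define S2 where "S2 = S1 - {p}"
    \<comment> \<open>The new colour of \<open>p\<close> must avoid \<phi> p, now at
      \<open>x\<close>, the colour \<alpha> of its m other neighbours, and at most one colour on
      behalf of each of these. That makes at most m + 2 colours, against a list of at least m +
      3.\<close>
    define D where "D = {\<phi> p, \<alpha>} \<union> (\<Union>s\<in>?M. mono_color \<phi> (nb S2 s))"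
    have "card D < card (L p)"
    proof -
      have "card D \<le> card {\<phi> p, \<alpha>} + card ?M"
        unfolding D_def
        by (intro order_trans[OF card_Un_le] add_mono card_UN_mono_color order_refl)
          (simp add: finite_nb S1)
      also have "card {\<phi> p, \<alpha>} \<le> 2"
        by (simp add: card_insert_if)
      finally have "card D \<le> card ?M + 2"
        by simp
      moreover have "card (nb S p) = Suc (card ?M)"
        using card_nb_remove[of S x p] pq x S1 by (simp add: S1_def)
      moreover have "card (nb S p) + 2 \<le> card (L p)"
        using ad xp by (auto simp: admissible_def)
      ultimately show ?thesis
        by linarith
    qed
    then obtain d where d: "d \<in> L p" "d \<notin> D"
      using ex_outside[of D "L p"] S1 by (auto simp: D_def finite_nb)
    define \<psi> where "\<psi> = \<phi>(x := \<phi> p, p := d)"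
    have \<psi>x: "\<psi> x = \<phi> p" and \<psi>p: "\<psi> p = d" and \<psi>o: "\<And>w. w \<noteq> x \<Longrightarrow> w \<noteq> p \<Longrightarrow> \<psi> w = \<phi> w"
      using xp by (auto simp: \<psi>_def)
    have nbp: "nb S p = insert x ?M" and nbq: "nb S q = insert x ?N"
      using xp x by (auto simp: nb_def S1_def)
    have Mo: "\<psi> w = \<alpha>" if "w \<in> ?M" for w
    proof -
      have "w \<noteq> x" "w \<noteq> p"
        using that by (auto simp: nb_def S1_def irrefl)
      then show ?thesis
        using that \<alpha>M \<psi>o by auto
    qed
    have No: "\<psi> w = \<beta>" if "w \<in> ?N" for w
    proof -
      have "w \<noteq> x" "w \<noteq> p"
        using that npq by (auto simp: nb_def S1_def irrefl)
      then show ?thesis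
        using that \<beta>N \<psi>o by auto
    qed
    have "\<psi> w \<in> L w" if "w \<in> S" for w
      using that g LxB \<open>B = set _\<close> d by (auto simp: \<psi>_def good_def)
    moreover have "\<psi> u \<noteq> \<psi> w" if w: "w \<in> S" "u \<in> nb S w" for u w
    proof -
      have *: "\<psi> p \<noteq> \<psi> u" if "u \<in> nb S p" for u
        using that nbp Mo \<psi>x \<psi>p d(2) by (auto simp: D_def)
      have **: "\<psi> x \<noteq> \<psi> u" if "u \<in> nb S x" for u
        using that pq *[of x] nbp \<psi>x \<psi>o[of q] xp dist by auto
      have "w \<in> nb S u"
        using w by (auto simp: nb_def sym)
      show ?thesis
      proof (cases "w \<in> {p, x} \<or> u \<in> {p, x}")
        case True
        then consider "w = p" | "w = x" | "u = p" | "u = x"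
          by blast
        then show ?thesis
        proof cases
          case 1
          then show ?thesis
            using *[of u] w by simp
        next
          case 2
          then show ?thesis
            using **[of u] w by simp
        next
          case 3
          then show ?thesis
            using *[of w] \<open>w \<in> nb S u\<close> by simp
        next
          case 4
          then show ?thesis
            using **[of w] \<open>w \<in> nb S u\<close> by simp
        qed
      next
        case False
        then show ?thesis
          using g w \<psi>o by (auto simp: good_def)
      qed
    qed
    moreover have "uniq \<psi> (nb S w)" if w: "w \<in> S - {x}" "nb S w \<noteq> {}" for w
    proof -
      \<comment> \<open>Both \<open>p\<close> and \<open>q\<close> see \<phi> p only at
        \<open>x\<close>, the rest of their neighbourhoods having colour \<alpha> or \<beta>. The
        choice of \<open>d\<close> serves the other neighbours of \<open>p\<close>.\<close>
      consider "w = p" | "w = q" | "w \<in> ?M" | "\<not> E w x" "\<not> E w p" "w \<noteq> p" "w \<noteq> q"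
        using nx[of w] w by (auto simp: nb_def S1_def E_commute[of w])
      then show ?thesis
      proof cases
        case 1
        then show ?thesis
          using nbp Mo \<psi>x dist by (auto simp: uniq_def)
      next
        case 2
        then show ?thesis
          using nbq No \<psi>x dist by (auto simp: uniq_def)
      next
        case 3
        then have w3: "w \<in> S" "\<not> E w x" "E w p" "w \<noteq> p"
          using npq nx[of w] sym irrefl xp by (auto simp: nb_def S1_def)
        have eq: "nb S w = insert p (nb S2 w)"
          using w3 xp by (auto simp: S2_def S1_def nb_def)
        have "p \<notin> nb S2 w" "finite (nb S2 w)"
          using S1 by (auto simp: S2_def nb_def)
        moreover have "card (nb S w) \<le> 3"
          using ad w3 by (auto simp: admissible_def)
        ultimately have "card (nb S2 w) \<le> 2"
          using eq by simp
        have "uniq (\<phi>(p := d)) (insert p (nb S2 w))"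
          using \<open>p \<notin> nb S2 w\<close> \<open>finite (nb S2 w)\<close> \<open>card (nb S2 w) \<le> 2\<close> d(2) 3
          by (intro uniq_insert) (auto simp: D_def)
        moreover have "uniq \<psi> (nb S w) = uniq (\<phi>(p := d)) (nb S w)"
          using w3 by (intro uniq_cong) (auto simp: \<psi>_def nb_def)
        ultimately show ?thesis
          using eq by simp
      next
        case 4
        then have "uniq \<psi> (nb S w) = uniq \<phi> (nb S w)"
          by (intro uniq_cong \<psi>o) (auto simp: nb_def)
        then show ?thesis
          using w g by (auto simp: good_def)
      qed
    qed
    ultimately have "good S {x} \<psi>"
      by (simp add: good_def)
    then show thesis
    proof (rule that)
      show "\<psi> x \<noteq> \<phi> x"
        using \<psi>x dist by auto
      show "\<psi> w = \<phi> w" if "w \<noteq> x" "\<phi> w = \<phi> x" for w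
        using that \<psi>o[of w] dist by (cases "w = p") auto
    qed
  qed
qed

section \<open>Extending a colouring to a deleted vertex\<close>

lemma good_weaken: "good S T \<phi> \<Longrightarrow> T \<subseteq> T' \<Longrightarrow> good S T' \<phi>"
  by (auto simp: good_def)

text \<open>The counting form of \<open>good_extend\<close>: it remains to list fewer forbidden
  colours than \<open>L v\<close> has.\<close>

lemma extend_vertex:
  assumes "admissible S" "v \<in> S" "good (S - {v}) T \<phi>" "T \<subseteq> nb S v"
    and "nb S v \<noteq> {} \<Longrightarrow> uniq \<phi> (nb S v)"
    and "\<phi> ` nb S v \<union> (\<Union>x\<in>nb S v. mono_color \<phi> (nb (S - {v}) x)) \<subseteq> set cs"
    and "length cs < card (L v)"
  shows "\<exists>\<psi>. good S {} \<psi>"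
proof -
  have nb: "nb (S - {v}) v = nb S v"
    by (simp add: nb_Diff)
  have "card (set cs) < card (L v)"
    using assms(7) card_length[of cs] by linarith
  then obtain c where c: "c \<in> L v" "c \<notin> set cs"
    using ex_outside[of "set cs"] by auto
  have "good (insert v (S - {v})) {} (\<phi>(v := c))"
    using assms c by (intro good_extend) (auto simp: nb card_nb_remove_le admissible_def)
  then show ?thesis
    using assms(2) by (auto simp: insert_absorb)
qed

text \<open>Deleting \<open>v\<close> lowers the degree of \<open>x\<close> but keeps its list, so
  \<open>recolor\<close> applies to \<open>x\<close> in \<open>S - {v}\<close>. As \<open>x\<close>
  is adjacent to \<open>v\<close>, the colour of \<open>v\<close> can later restore its
  condition.\<close>

lemma separate:
  assumes "admissible S" "v \<in> S" "x \<in> nb S v" "good (S - {v}) {} \<phi>"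
  obtains \<psi> where "good (S - {v}) {x} \<psi>"
    "\<And>y. y \<in> nb S v \<Longrightarrow> \<phi> y = \<phi> x \<Longrightarrow> y \<noteq> x \<Longrightarrow> \<psi> y = \<phi> y" "\<psi> x \<noteq> \<phi> x"
proof (rule recolor)
  have x: "x \<in> S" "x \<noteq> v"
    using assms(3) by (auto simp: nb_def irrefl)
  then have "card (nb S x) + 2 \<le> card (L x)"
    using assms(1) by (auto simp: admissible_def)
  moreover have c: "card (nb S x) = Suc (card (nb (S - {v}) x))"
    using assms by (intro card_nb_remove) (auto simp: admissible_def)
  ultimately show "card (nb (S - {v}) x) + 3 \<le> card (L x)"
    by linarith
  show "card (nb (S - {v}) x) \<le> 2"
    using c assms(1) x by (auto simp: admissible_def)
  show "admissible (S - {v})"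
    using assms(1) by (rule admissible_subset) auto
  show "x \<in> S - {v}"
    using x by simp
  show "good (S - {v}) {} \<phi>"
    by fact
next
  fix \<psi>
  assume "good (S - {v}) {x} \<psi>" "\<psi> x \<noteq> \<phi> x"
    and *: "\<And>w. w \<in> S - {v} \<Longrightarrow> w \<noteq> x \<Longrightarrow> \<phi> w = \<phi> x \<Longrightarrow> \<psi> w = \<phi> w"
  moreover have "y \<in> S - {v}" if "y \<in> nb S v" for y
    using that by (auto simp: nb_def irrefl)
  ultimately show thesis
    by (intro that) auto
qed

text \<open>If the colours agree, recolouring \<open>x\<close> separates them, since
  \<open>y\<close> keeps the common colour.\<close>

lemma separate_pair:
  assumes "admissible S" "v \<in> S" "x \<in> nb S v" "y \<in> nb S v" "x \<noteq> y" "good (S - {v}) {} \<phi>"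
  obtains \<psi> where "good (S - {v}) {x} \<psi>" "\<psi> x \<noteq> \<psi> y"
proof (cases "\<phi> x = \<phi> y")
  case True
  show ?thesis
    by (rule separate[OF assms(1-3,6)]) (use that True assms(4,5) in metis)
next
  case False
  then show ?thesis
    using that good_weaken[OF assms(6)] by blast
qed

text \<open>The two remaining neighbours of \<open>x\<close> have distinct colours by the condition
  at \<open>x\<close>. So \<open>x\<close> forbids only its own colour at \<open>v\<close>.\<close>

lemma mono_color_cubic:
  assumes "admissible S" "v \<in> S" "x \<in> nb S v" "good (S - {v}) T \<phi>" "x \<notin> T" "card (nb S x) = 3"
  shows "mono_color \<phi> (nb (S - {v}) x) = {}"
proof -
  have c: "card (nb (S - {v}) x) = 2"
    using card_nb_remove[of S v x] assms by (simp add: admissible_def)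
  moreover have "x \<in> S - {v} - T"
    using assms(3,5) by (auto simp: nb_def irrefl)
  moreover have "nb (S - {v}) x \<noteq> {}"
    using c by auto
  ultimately have "uniq \<phi> (nb (S - {v}) x)"
    using assms(4) by (simp add: good_def)
  then show ?thesis
    using c by (rule uniq_2_mono_color)
qed

section \<open>Reducible configurations\<close>

lemma color_isolated:
  assumes "admissible S" "v \<in> S" "nb S v = {}" "good (S - {v}) {} \<phi>"
  shows "\<exists>\<psi>. good S {} \<psi>"
  using assms by (intro extend_vertex[of S v "{}" \<phi> "[]"]) (force simp: admissible_def)+

lemma color_leaf:
  assumes "admissible S" "v \<in> S" "nb S v = {x}" "good (S - {v}) {} \<phi>"
  shows "\<exists>\<psi>. good S {} \<psi>"
proof -
  obtain d where d: "mono_color \<phi> (nb (S - {v}) x) \<subseteq> {d}"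
    using mono_color_sub by (rule exE)
  have "3 \<le> card (L v)"
    using assms(1-3) by (force simp: admissible_def)
  then show ?thesis
    using d by (intro extend_vertex[OF assms(1,2,4), of "[\<phi> x, d]"]) (auto simp: assms(3))
qed

text \<open>Two neighbours forbid at most four colours, and separating them gives \<open>v\<close>
  its unique colour.\<close>

lemma color_long_list:
  assumes "admissible S" "v \<in> S" "nb S v = {x, y}" "x \<noteq> y" "5 \<le> card (L v)" "good (S - {v}) {} \<phi>"
  shows "\<exists>\<psi>. good S {} \<psi>"
proof -
  have xy: "x \<in> nb S v" "y \<in> nb S v"
    by (simp_all add: assms(3))
  obtain \<psi> where \<psi>: "good (S - {v}) {x} \<psi>" "\<psi> x \<noteq> \<psi> y"
    by (rule separate_pair[OF assms(1,2) xy assms(4,6)])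
  obtain d where d: "mono_color \<psi> (nb (S - {v}) x) \<subseteq> {d}"
    using mono_color_sub by (rule exE)
  obtain e where e: "mono_color \<psi> (nb (S - {v}) y) \<subseteq> {e}"
    using mono_color_sub by (rule exE)
  show ?thesis
    using d e \<psi>(2) assms(5)
    by (intro extend_vertex[OF assms(1,2) \<psi>(1), of "[\<psi> x, \<psi> y, d, e]"])
      (auto simp: assms(3) intro: uniq_pair)
qed

text \<open>A cubic neighbour forbids one colour instead of two, so at most three are excluded from
  a list of at least four.\<close>

lemma color_cubic_neighbour:
  assumes "admissible S" "v \<in> S" "nb S v = {x, y}" "x \<noteq> y" "card (nb S x) = 3"
    and "good (S - {v}) {} \<phi>"
  shows "\<exists>\<psi>. good S {} \<psi>"
proof -
  have xy: "x \<in> nb S v" "y \<in> nb S v"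
    by (simp_all add: assms(3))
  \<comment> \<open>Recolouring the other neighbour keeps the neighbourhood of \<open>x\<close> bichromatic.\<close>
  obtain \<psi> where \<psi>: "good (S - {v}) {y} \<psi>" "\<psi> y \<noteq> \<psi> x"
    by (rule separate_pair[OF assms(1,2) xy(2,1) assms(4)[symmetric] assms(6)])
  have m: "mono_color \<psi> (nb (S - {v}) x) = {}"
    using assms(4,5) by (intro mono_color_cubic[OF assms(1,2) xy(1) \<psi>(1)]) simp_all
  obtain e where e: "mono_color \<psi> (nb (S - {v}) y) \<subseteq> {e}"
    using mono_color_sub by (rule exE)
  have "4 \<le> card (L v)"
    using assms(1-4) by (force simp: admissible_def)
  then show ?thesis
    using e m \<psi>(2) by (intro extend_vertex[OF assms(1,2) \<psi>(1), of "[\<psi> x, \<psi> y, e]"])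
      (auto simp: assms(3) intro: uniq_pair)
qed

text \<open>After the deletion \<open>x\<close> and \<open>y\<close> see only each other, so \<phi>
  x and \<phi> y are the only forbidden colours; they differ by adjacency.\<close>

lemma color_triangle:
  assumes "admissible S" "v \<in> S" "nb S v = {x, y}" "x \<noteq> y" "nb S x = {v, y}" "nb S y = {v, x}"
    and "good (S - {v}) {} \<phi>"
  shows "\<exists>\<psi>. good S {} \<psi>"
proof -
  have xy: "x \<in> S - {v}" "y \<in> nb (S - {v}) x" "nb (S - {v}) x = {y}" "nb (S - {v}) y = {x}"
    using assms(3-6) not_nb_self[of v S] nb_subset[of S v] by (auto simp: nb_Diff)
  then have "\<phi> x \<noteq> \<phi> y"
    using assms(7) unfolding good_def by metis
  moreover have "4 \<le> card (L v)"
    using assms(1-4) by (force simp: admissible_def)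
  ultimately show ?thesis
    by (intro extend_vertex[OF assms(1,2,7), of "[\<phi> x, \<phi> y]"])
      (auto simp: assms(3) xy(3,4) intro: uniq_pair)
qed

text \<open>Both neighbours forbid the same additional colour, that of \<open>w\<close>. The
  condition at \<open>w\<close> already makes \<phi> x and \<phi> y differ.\<close>

lemma color_quadrangle:
  assumes "admissible S" "v \<in> S" "nb S v = {x, y}" "x \<noteq> y" "nb S x = {v, w}" "nb S y = {v, w}"
    and "w \<noteq> v" "card (nb S w) = 2" "good (S - {v}) {} \<phi>"
  shows "\<exists>\<psi>. good S {} \<psi>"
proof -
  have "w \<in> nb S x" "w \<in> nb S y" "x \<in> nb S v" "y \<in> nb S v"
    by (simp_all add: assms(3,5,6))
  then have "x \<in> nb S w" "y \<in> nb S w" "w \<in> S"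
    by (auto simp: nb_def E_commute)
  moreover obtain t where "nb S w = {x, t}"
    using card_2_other[OF assms(8) \<open>x \<in> nb S w\<close>] by blast
  ultimately have w: "nb S w = {x, y}" "w \<in> S"
    using assms(4) by auto
  have "v \<noteq> x" "v \<noteq> y"
    using assms(3) not_nb_self[of v S] by auto
  then have nb: "nb (S - {v}) w = {x, y}" "nb (S - {v}) x = {w}" "nb (S - {v}) y = {w}"
    using w(1) assms(5-7) by (auto simp: nb_Diff)
  have "w \<in> S - {v} - {}"
    using w(2) assms(7) by simp
  then have "uniq \<phi> {x, y}"
    using assms(9) nb(1) unfolding good_def by (metis insert_not_empty)
  moreover have "4 \<le> card (L v)"
    using assms(1-4) by (force simp: admissible_def)
  ultimately show ?thesis
    by (intro extend_vertex[OF assms(1,2,9), of "[\<phi> x, \<phi> y, \<phi> w]"])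
      (auto simp: assms(3) nb(2,3))
qed

text \<open>If \<open>x\<close>, \<open>y\<close>, \<open>z\<close> share a colour, \<open>x\<close>
  is recoloured. Only \<open>x\<close> can lose its condition, so \<open>y\<close> and
  \<open>z\<close> forbid one colour each and \<open>x\<close> at most two, against a list of at
  least five.\<close>

lemma color_cubic:
  assumes "admissible S" "v \<in> S" "card (nb S v) = 3" "\<And>x. x \<in> nb S v \<Longrightarrow> card (nb S x) = 3"
    and "good (S - {v}) {} \<phi>"
  shows "\<exists>\<psi>. good S {} \<psi>"
proof -
  obtain x y z where xyz: "nb S v = {x, y, z}" "x \<noteq> y" "y \<noteq> z" "x \<noteq> z"
    using assms(3) by (auto simp: card_3_iff)
  obtain \<psi> where \<psi>: "good (S - {v}) {x} \<psi>" "mono_color \<psi> (nb S v) = {}"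
  proof (cases "\<phi> y = \<phi> x \<and> \<phi> z = \<phi> x")
    case True
    have "x \<in> nb S v"
      by (simp add: xyz(1))
    from assms(1,2) this assms(5) show thesis
    proof (rule separate)
      fix \<psi>
      assume \<psi>: "good (S - {v}) {x} \<psi>" "\<psi> x \<noteq> \<phi> x"
        "\<And>y. y \<in> nb S v \<Longrightarrow> \<phi> y = \<phi> x \<Longrightarrow> y \<noteq> x \<Longrightarrow> \<psi> y = \<phi> y"
      have "\<psi> y = \<phi> x"
        using \<psi>(3)[of y] True xyz(1,2) by simp
      then have "mono_color \<psi> (nb S v) = {}"
        using \<psi>(2) by (simp add: xyz(1))
      with \<psi>(1) show thesis
        by (rule that)
    qed
  next
    case False
    then have "mono_color \<phi> (nb S v) = {}"
      by (simp add: xyz(1))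
    with good_weaken[OF assms(5) empty_subsetI] show thesis
      by (rule that)
  qed
  obtain e where "mono_color \<psi> (nb (S - {v}) x) \<subseteq> {e}"
    using mono_color_sub by (rule exE)
  moreover have "mono_color \<psi> (nb (S - {v}) u) = {}" if "u = y \<or> u = z" for u
    using that xyz assms(4)[of u] by (intro mono_color_cubic[OF assms(1,2) _ \<psi>(1)]) auto
  moreover have "5 \<le> card (L v)"
    using assms(1-3) by (force simp: admissible_def)
  ultimately show ?thesis
    using uniq_3[OF assms(3) \<psi>(2)]
    by (intro extend_vertex[OF assms(1,2) \<psi>(1), of "[\<psi> x, \<psi> y, \<psi> z, e]"])
      (auto simp: xyz(1))
qed

text \<open>The conditions at \<open>b\<close> and \<open>c\<close> separate the colours at distance
  two, which with properness gives the 4-cycle \<open>a\<close>, \<open>b\<close>, \<open>d\<close>,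
  \<open>c\<close> with chord \<open>b\<close>, \<open>c\<close>. The colours outside cost
  \<open>a\<close> and \<open>d\<close> two colours each, \<open>b\<close> and \<open>c\<close> one
  each. In the 6-cycle, \<open>p'\<close> is \<open>q\<close>.\<close>

lemma color_long_path:
  assumes ad: "admissible S" and dist: "distinct [p, a, b, c, d, q]"
    and nb: "nb S a = {p, b}" "nb S b = {a, c}" "nb S c = {b, d}" "nb S d = {c, q}"
    and pq: "nb S p = {a, p'}" "p' \<noteq> a" "nb S q = {d, q'}" "q' \<noteq> d"
    and g: "good (S - {a, b, c, d}) {} \<phi>"
  shows "\<exists>\<psi>. good S {} \<psi>"
proof -
  let ?S = "S - {a, b, c, d}"
  have "a \<in> nb S b" "b \<in> nb S a" "c \<in> nb S b" "d \<in> nb S c" "p \<in> nb S a" "q \<in> nb S d"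
    "p' \<in> nb S p" "q' \<in> nb S q"
    by (simp_all add: nb pq)
  then have S: "a \<in> S" "b \<in> S" "c \<in> S" "d \<in> S" "p \<in> S" "q \<in> S" "p' \<in> S" "q' \<in> S"
    and E: "E p p'" "E q q'"
    by (auto simp: nb_def)
  have adj: "E a w \<longleftrightarrow> w \<in> {p, b}" "E b w \<longleftrightarrow> w \<in> {a, c}" "E c w \<longleftrightarrow> w \<in> {b, d}" "E d w \<longleftrightarrow> w \<in> {c, q}"
    if "w \<in> S" for w
    unfolding nb[symmetric] using that by (simp_all add: nb_def)
  have p': "p' \<notin> {a, b, c, d}"
    using E(1) pq(2) adj(2-4)[OF S(5)] dist E_commute[of p p'] by auto
  have q': "q' \<notin> {a, b, c, d}"
    using E(2) pq(4) adj(1-3)[OF S(6)] dist E_commute[of q q'] by auto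
  have pS: "p \<in> ?S" "q \<in> ?S" "p' \<in> ?S" "q' \<in> ?S"
    using S dist p' q' by auto
  have \<phi>: "\<phi> w \<in> L w" "u \<in> nb ?S w \<Longrightarrow> \<phi> u \<noteq> \<phi> w" "nb ?S w \<noteq> {} \<Longrightarrow> uniq \<phi> (nb ?S w)" 
    if "w \<in> ?S" for u w
    using g that by (auto simp: good_def)
  have pp': "\<phi> p' \<noteq> \<phi> p" "\<phi> q' \<noteq> \<phi> q"
    using \<phi>(2)[OF pS(1)] \<phi>(2)[OF pS(2)] pS E by (auto simp: nb_def)
  have card4: "4 \<le> card (L v)" if "v \<in> S" "nb S v = {x, y}" "x \<noteq> y" for v x y
    using ad that by (force simp: admissible_def)
  have La: "4 \<le> card (L a)" and Lb: "4 \<le> card (L b)" and Lc: "4 \<le> card (L c)" and Ld: "4 \<le> card (L d)"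
    using card4[OF S(1) nb(1)] card4[OF S(2) nb(2)] card4[OF S(3) nb(3)] card4[OF S(4) nb(4)] dist
    by auto
  have diff: "card A - length xs \<le> card (A - set xs)" for A :: "'c set" and xs
    using diff_card_le_card_Diff[of "set xs" A] card_length[of xs] by simp
  obtain \<alpha> \<beta> \<gamma> \<delta> where new: "\<alpha> \<in> L a - set [\<phi> p, \<phi> p']" "\<beta> \<in> L b - set [\<phi> p]"
      "\<gamma> \<in> L c - set [\<phi> q]" "\<delta> \<in> L d - set [\<phi> q, \<phi> q']"
    and ne: "\<alpha> \<noteq> \<beta>" "\<alpha> \<noteq> \<gamma>" "\<beta> \<noteq> \<gamma>" "\<beta> \<noteq> \<delta>" "\<gamma> \<noteq> \<delta>"
  proof (rule list_color_diamond)
    show "2 \<le> card (L a - set [\<phi> p, \<phi> p'])"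
      using diff[of "L a" "[\<phi> p, \<phi> p']"] La by simp
    show "3 \<le> card (L b - set [\<phi> p])"
      using diff[of "L b" "[\<phi> p]"] Lb by simp
    show "3 \<le> card (L c - set [\<phi> q])"
      using diff[of "L c" "[\<phi> q]"] Lc by simp
    show "2 \<le> card (L d - set [\<phi> q, \<phi> q'])"
      using diff[of "L d" "[\<phi> q, \<phi> q']"] Ld by simp
  qed
  define \<psi> where "\<psi> = \<phi>(a := \<alpha>, b := \<beta>, c := \<gamma>, d := \<delta>)"
  have \<psi>: "\<psi> a = \<alpha>" "\<psi> b = \<beta>" "\<psi> c = \<gamma>" "\<psi> d = \<delta>"
    using dist by (auto simp: \<psi>_def)
  have \<psi>\<phi>: "\<psi> w = \<phi> w" if "w \<in> ?S" for w
    using that by (simp add: \<psi>_def)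
  note val = \<psi> pS[THEN \<psi>\<phi>]
  have "\<psi> w \<in> L w \<and> (\<forall>u\<in>nb S w. \<psi> u \<noteq> \<psi> w) \<and> (nb S w \<noteq> {} \<longrightarrow> uniq \<psi> (nb S w))" if w: "w \<in> S" for w
  proof -
    consider "w = a" | "w = b" | "w = c" | "w = d" | "w = p" | "w = q" | "w \<in> ?S" "w \<noteq> p" "w \<noteq> q"
      using w by blast
    then show ?thesis
    proof cases
      case 1
      show ?thesis
        unfolding 1 nb(1) using new(1) new(2) ne by (auto simp: val intro: uniq_pair)
    next
      case 2
      show ?thesis
        unfolding 2 nb(2) using new(2) ne by (auto simp: val intro: uniq_pair)
    next
      case 3
      show ?thesis
        unfolding 3 nb(3) using new(3) ne by (auto simp: val intro: uniq_pair)
    next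
      case 4
      show ?thesis
        unfolding 4 nb(4) using new(3,4) ne by (auto simp: val intro: uniq_pair)
    next
      case 5
      show ?thesis
        unfolding 5 pq(1) using new(1) pp' \<phi>(1)[OF pS(1)] by (auto simp: val intro: uniq_pair)
    next
      case 6
      show ?thesis
        unfolding 6 pq(3) using new(4) pp' \<phi>(1)[OF pS(2)] by (auto simp: val intro: uniq_pair)
    next
      case 7
      have "\<not> E w a" "\<not> E w b" "\<not> E w c" "\<not> E w d"
        using adj[OF w] 7 E_commute[of w] by auto
      then have eq: "nb S w = nb ?S w"
        by (auto simp: nb_def)
      have sub: "u \<in> ?S" if "u \<in> nb ?S w" for u
        using that nb_subset by blast
      have "uniq \<psi> (nb ?S w) = uniq \<phi> (nb ?S w)"
        by (rule uniq_cong) (rule \<psi>\<phi>[OF sub])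
      then show ?thesis
        unfolding eq using \<phi>[OF 7(1)] \<psi>\<phi>[OF 7(1)] \<psi>\<phi>[OF sub] by simp
    qed
  qed
  then have "good S {} \<psi>"
    unfolding good_def by simp
  then show ?thesis
    by (rule exI[of _ \<psi>])
qed

section \<open>Pentagons and cycle components\<close>

definition bad_pentagon :: "'a set \<Rightarrow> 'a \<Rightarrow> 'a \<Rightarrow> 'a \<Rightarrow> 'a \<Rightarrow> 'a \<Rightarrow> bool" where
  "bad_pentagon S a b c d e \<longleftrightarrow> distinct [a, b, c, d, e] \<and>
     nb S a = {e, b} \<and> nb S b = {a, c} \<and> nb S c = {b, d} \<and> nb S d = {c, e} \<and> nb S e = {d, a} \<and>
     (\<forall>v\<in>{a, b, c, d, e}. card (L v) = 4)"

text \<open>By admissibility a list of size 4 allows at most two neighbours in \<open>S\<close>, and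
  two already lie in \<open>S'\<close>. Hence the list sizes in \<open>bad_pentagon\<close>: with
  them, no bad pentagon can arise by deletion.\<close>

lemma bad_pentagon_mono:
  assumes "bad_pentagon S' a b c d e" "S' \<subseteq> S" "admissible S"
  shows "bad_pentagon S a b c d e"
proof -
  have eq: "nb S v = nb S' v" if "v \<in> S'" "card (nb S' v) = 2" "card (L v) = 4" for v
  proof (rule card_seteq[symmetric])
    show "finite (nb S v)"
      using assms(3) by (simp add: admissible_def finite_nb)
    show "nb S' v \<subseteq> nb S v"
      using assms(2) by (auto simp: nb_def)
    show "card (nb S v) \<le> card (nb S' v)"
      using that assms(2,3) by (force simp: admissible_def)
  qed
  have nb: "nb S' a = {e, b}" "nb S' b = {a, c}" "nb S' c = {b, d}" "nb S' d = {c, e}" "nb S' e = {d, a}"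
    and dist: "distinct [a, b, c, d, e]"
    and card: "card (L a) = 4" "card (L b) = 4" "card (L c) = 4" "card (L d) = 4" "card (L e) = 4"
    using assms(1) by (simp_all add: bad_pentagon_def)
  have "a \<in> nb S' b" "b \<in> nb S' a" "c \<in> nb S' b" "d \<in> nb S' c" "e \<in> nb S' a"
    by (simp_all add: nb)
  then have S': "a \<in> S'" "b \<in> S'" "c \<in> S'" "d \<in> S'" "e \<in> S'"
    using nb_subset by blast+
  have "nb S a = {e, b}"
    using eq[OF S'(1) _ card(1)] nb(1) dist by (simp add: card_insert_if eq_commute[of e])
  moreover have "nb S b = {a, c}"
    using eq[OF S'(2) _ card(2)] nb(2) dist by simp
  moreover have "nb S c = {b, d}"
    using eq[OF S'(3) _ card(3)] nb(3) dist by simp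
  moreover have "nb S d = {c, e}"
    using eq[OF S'(4) _ card(4)] nb(4) dist by simp
  moreover have "nb S e = {d, a}"
    using eq[OF S'(5) _ card(5)] nb(5) dist by (simp add: card_insert_if eq_commute[of d])
  ultimately show ?thesis
    using dist card by (simp add: bad_pentagon_def)
qed

text \<open>From \<open>v\<close> one walks inside \<open>C\<close> in both directions, along
  \<open>x\<close>, \<open>x'\<close>, \<open>x''\<close> and \<open>y\<close>, \<open>y'\<close>,
  \<open>y''\<close>. The coincidences \<open>x' = y\<close>, \<open>x' = y'\<close>,
  \<open>x'' = y'\<close> close cycles of length 3, 4, 5; otherwise \<open>color_long_path\<close>
  applies.\<close>

lemma color_cycle:
  assumes ad: "admissible S" and nb2: "\<And>u. u \<in> S \<Longrightarrow> u \<in> C \<Longrightarrow> card (nb S u) = 2 \<and> card (L u) = 4 \<and> nb S u \<subseteq> C"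
    and v: "v \<in> S" "v \<in> C"
    and no: "\<nexists>a b c d e. bad_pentagon S a b c d e"
    and del: "\<And>T. T \<noteq> {} \<Longrightarrow> T \<subseteq> S \<Longrightarrow> \<exists>\<phi>. good (S - T) {} \<phi>"
  shows "\<exists>\<psi>. good S {} \<psi>"
proof -
  have other: "\<exists>w. nb S u = {t, w} \<and> t \<noteq> w \<and> w \<in> S \<and> w \<in> C \<and> u \<in> nb S w \<and> u \<noteq> w"
    if u: "u \<in> S" "u \<in> C" and t: "t \<in> nb S u" for u t
  proof -
    obtain w where w: "nb S u = {t, w}" "t \<noteq> w"
      using card_2_other[OF _ t] nb2[OF u] by metis
    then have "w \<in> nb S u"
      by simp
    then have "w \<in> S" "w \<in> C" "u \<in> nb S w" "u \<noteq> w"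
      using nb2[OF u] nb_subset nb_sym[OF _ u(1)] not_nb_self by blast+
    with w show ?thesis
      by blast
  qed
  obtain \<phi> where \<phi>: "good (S - {v}) {} \<phi>"
    using del[of "{v}"] v by auto
  obtain x where x: "x \<in> nb S v"
    using nb2[OF v] by fastforce
  have xS: "x \<in> S" "x \<in> C" "v \<in> nb S x" "v \<noteq> x"
    using x nb2[OF v] nb_subset nb_sym[OF x v(1)] not_nb_self by blast+
  obtain y where y: "nb S v = {x, y}" "x \<noteq> y" "y \<in> S" "y \<in> C" "v \<in> nb S y" "v \<noteq> y"
    using other[OF v x] by blast
  obtain x' where x': "nb S x = {v, x'}" "v \<noteq> x'" "x' \<in> S" "x' \<in> C" "x \<in> nb S x'" "x \<noteq> x'"
    using other[OF xS(1-3)] by blast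
  obtain y' where y': "nb S y = {v, y'}" "v \<noteq> y'" "y' \<in> S" "y' \<in> C" "y \<in> nb S y'" "y \<noteq> y'"
    using other[OF y(3-5)] by blast
  show ?thesis
  proof (cases "x' = y")
    case True
    then have "nb S y = {v, x}"
      using x'(5) y'(1) xS(4) by auto
    then show ?thesis
      using color_triangle[OF ad v(1) y(1,2) _ _ \<phi>] x'(1) True by blast
  next
    case x'y: False
    show ?thesis
    proof (cases "x' = y'")
      case True
      then show ?thesis
        using color_quadrangle[OF ad v(1) y(1,2) x'(1) _ _ _ \<phi>] y'(1) x'(2) nb2[OF x'(3,4)] by simp
    next
      case x'y': False
      have y'x: "y' \<noteq> x"
        using y'(5) x'(1) x'y y(6) by auto
      obtain x'' where x'': "nb S x' = {x, x''}" "x \<noteq> x''" "x'' \<in> S" "x'' \<in> C" "x' \<in> nb S x''" "x' \<noteq> x''"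
        using other[OF x'(3-5)] by blast
      obtain y'' where y'': "nb S y' = {y, y''}" "y \<noteq> y''" "y'' \<in> S" "y'' \<in> C" "y' \<in> nb S y''" "y' \<noteq> y''"
        using other[OF y'(3-5)] by blast
      have ne: "x'' \<noteq> v" "x'' \<noteq> y" "y'' \<noteq> v" "y'' \<noteq> x"
        using x''(5) y''(5) y(1) x'(1) y'(1) x'(6) y'(6) x'y x'y' y'x x'(2) y'(2) by auto
      show ?thesis
      proof (cases "x'' = y'")
        case True
        then have "y'' = x'"
          using x''(5) y''(1) x'y by auto
        then have "bad_pentagon S v x x' y' y"
          unfolding bad_pentagon_def
          using True y x' y' x'' y'' x'y x'y' y'x xS(4) nb2[OF v] nb2[OF xS(1,2)] nb2[OF y(3,4)]
            nb2[OF x'(3,4)] nb2[OF y'(3,4)]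
          by (simp add: insert_commute)
        then show ?thesis
          using no by blast
      next
        case False
        \<comment> \<open>The path to delete is \<open>x'\<close>, \<open>x\<close>,
          \<open>v\<close>, \<open>y\<close>, between \<open>x''\<close> and \<open>y'\<close>; here
          \<open>x''\<close> may equal \<open>y''\<close>.\<close>
        obtain p' where p': "nb S x'' = {x', p'}" "x' \<noteq> p'"
          using other[OF x''(3-5)] by blast
        have "\<exists>\<phi>. good (S - {x', x, v, y}) {} \<phi>"
          using x'(3) xS(1) v(1) y(3) by (intro del) simp_all
        then obtain \<phi> where "good (S - {x', x, v, y}) {} \<phi>"
          by blast
        moreover have "distinct [x'', x', x, v, y, y']"
          using False y(2,6) x'(2,6) y'(2,6) x''(2,6) ne x'y x'y' y'x xS(4) by auto
        moreover have "nb S x' = {x'', x}" "nb S x = {x', v}"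
          using x''(1) x'(1) by auto
        moreover have "\<exists>q'. nb S y' = {y, q'} \<and> q' \<noteq> y"
          using y''(1,2) by metis
        ultimately show ?thesis
          using color_long_path[OF ad _ _ _ y(1) y'(1) p'(1) p'(2)[symmetric]] by metis
      qed
    qed
  qed
qed

section \<open>Induction over induced subgraphs\<close>

theorem ex_good:
  assumes "admissible S" "\<nexists>a b c d e. bad_pentagon S a b c d e"
  shows "\<exists>\<phi>. good S {} \<phi>"
proof -
  have "finite S"
    using assms(1) by (simp add: admissible_def)
  then show ?thesis
    using assms
  proof (induction S rule: finite_psubset_induct)
    case (psubset S)
    note ad = psubset.prems(1)
    \<comment> \<open>Unlike connectedness, the absence of bad pentagons passes to subsets.\<close>
    have del: "\<exists>\<phi>. good (S - T) {} \<phi>" if "T \<noteq> {}" "T \<subseteq> S" for T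
    proof (rule psubset.IH)
      show "S - T \<subset> S"
        using that by blast
      show "admissible (S - T)"
        using ad by (rule admissible_subset) blast
      show "\<nexists>a b c d e. bad_pentagon (S - T) a b c d e"
        using bad_pentagon_mono[OF _ Diff_subset ad] psubset.prems(2) by metis
    qed
    have del1: "\<exists>\<phi>. good (S - {v}) {} \<phi>" if "v \<in> S" for v
      using del[of "{v}"] that by simp
    show ?case
    proof (rule ccontr)
      assume none: "\<nexists>\<phi>. good S {} \<phi>"
      have deg: "card (nb S v) = 2 \<or> card (nb S v) = 3" if v: "v \<in> S" for v
      proof (rule ccontr)
        assume "\<not> ?thesis"
        moreover have "card (nb S v) \<le> 3"
          using ad v by (simp add: admissible_def)
        ultimately consider "card (nb S v) = 0" | "card (nb S v) = 1"
          by linarith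
        then show False
        proof cases
          case 1
          then have "nb S v = {}"
            using psubset.hyps by (simp add: finite_nb)
          then show False
            using color_isolated[OF ad v] del1[OF v] none by blast
        next
          case 2
          then obtain x where "nb S v = {x}"
            by (rule card_1_singletonE)
          then show False
            using color_leaf[OF ad v] del1[OF v] none by blast
        qed
      qed
      \<comment> \<open>In a minimal counterexample a vertex of degree 2 has neither a fifth colour
        nor a cubic neighbour, so \<open>C\<close> consists of cycle components.\<close>
      define C where "C = {v \<in> S. card (nb S v) = 2}"
      have C: "card (nb S v) = 2 \<and> card (L v) = 4 \<and> nb S v \<subseteq> C" if v: "v \<in> S" "v \<in> C" for v
      proof (intro conjI)
        show c: "card (nb S v) = 2"
          using v by (simp add: C_def)
        obtain \<phi> where \<phi>: "good (S - {v}) {} \<phi>"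
          using del1[OF v(1)] by blast
        have "4 \<le> card (L v)"
          using ad v(1) c by (force simp: admissible_def)
        moreover have "\<not> 5 \<le> card (L v)"
        proof
          assume "5 \<le> card (L v)"
          moreover obtain x y where "nb S v = {x, y}" "x \<noteq> y"
            using c by (meson card_2_iff)
          ultimately show False
            using color_long_list[OF ad v(1) _ _ _ \<phi>] none by blast
        qed
        ultimately show "card (L v) = 4"
          by linarith
        show "nb S v \<subseteq> C"
        proof
          fix x
          assume x: "x \<in> nb S v"
          obtain y where y: "nb S v = {x, y}" "x \<noteq> y"
            using card_2_other[OF c x] by blast
          have "card (nb S x) \<noteq> 3"
            using color_cubic_neighbour[OF ad v(1) y _ \<phi>] none by blast
          moreover have "x \<in> S"
            using x by (simp add: nb_def)
          ultimately show "x \<in> C"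
            using deg[of x] by (simp add: C_def)
        qed
      qed
      show False
      proof (cases "C = {}")
        case False
        then obtain v where "v \<in> C"
          by blast
        moreover from this have "v \<in> S"
          by (simp add: C_def)
        ultimately show False
          using color_cycle[OF ad C _ _ psubset.prems(2) del] none by blast
      next
        case True
        \<comment> \<open>Without vertices of degree 2 the graph is cubic, and
          \<open>color_cubic\<close> applies to any vertex.\<close>
        then have 3: "card (nb S v) = 3" if "v \<in> S" for v
          using deg[OF that] that by (auto simp: C_def)
        show False
        proof (cases "S = {}")
          case True
          then show False
            using none by (simp add: good_def)
        next
          case False
          then obtain v where v: "v \<in> S"
            by blast
          obtain \<phi> where \<phi>: "good (S - {v}) {} \<phi>"
            using del1[OF v] by blast
          have "card (nb S x) = 3" if "x \<in> nb S v" for x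
            using that by (intro 3) (simp add: nb_def)
          then show False
            using color_cubic[OF ad v 3[OF v] _ \<phi>] none by blast
        qed
      qed
    qed
  qed
qed

end

section \<open>Transfer to digraphs\<close>

lemma (in graph) connected_closed:
  assumes "Digraph_Component.connected G" "A \<noteq> {}" "A \<subseteq> verts G"
    and closed: "\<And>v. v \<in> A \<Longrightarrow> neighborhood G v \<subseteq> A"
  shows "verts G = A"
proof
  obtain u where u: "u \<in> A"
    using assms(2) by blast
  show "verts G \<subseteq> A"
  proof
    fix v
    assume "v \<in> verts G"
    then have "u \<rightarrow>\<^sup>*\<^bsub>mk_symmetric G\<^esub> v"
      using assms(1,3) u by (auto simp: connected_def strongly_connected_def)
    then have "u \<rightarrow>\<^sup>*\<^bsub>G\<^esub> v"
      by (simp add: reachable_mk_symmetric_eq[OF sym_arcs])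
    then show "v \<in> A"
    proof (induction rule: reachable_induct)
      case base
      show ?case
        by (rule u)
    next
      case (step x y)
      then show ?case
        using closed[of x] by (auto simp: neighborhood_def)
    qed
  qed
qed (rule assms(3))

lemma (in graph) digraph_iso_cycle_graphI:
  assumes inj: "inj_on f (verts G)" and img: "f ` verts G = {..<n}"
    and adj: "\<And>u v. u \<in> verts G \<Longrightarrow> v \<in> verts G \<Longrightarrow>
      u \<rightarrow>\<^bsub>G\<^esub> v \<longleftrightarrow> f v = Suc (f u) mod n \<or> f u = Suc (f v) mod n"
  shows "digraph_iso G (cycle_graph n)"
proof -
  \<comment> \<open>Arcs of \<open>cycle_graph\<close> are pairs of vertices, so an arc is sent to
    the images of its ends. This is injective because there are no parallel arcs.\<close>
  let ?g = "\<lambda>x. (f (tail G x), f (head G x))"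
  define h where "h = \<lparr>iso_verts = f, iso_arcs = ?g, iso_head = snd, iso_tail = fst\<rparr>"
  have "inj_on ?g (arcs G)"
  proof (rule inj_onI)
    fix x y
    assume xy: "x \<in> arcs G" "y \<in> arcs G" "?g x = ?g y"
    then have "tail G x = tail G y" "head G x = head G y"
      using inj_onD[OF inj] by auto
    then show "x = y"
      using xy(1,2) by (intro no_multi_arcs) (auto simp: arc_to_ends_def)
  qed
  then have "digraph_isomorphism h"
    using inj by (simp add: digraph_isomorphism_def h_def wf_digraph)
  moreover have "?g ` arcs G = arcs (cycle_graph n)"
  proof (intro equalityI subsetI)
    fix p
    assume "p \<in> ?g ` arcs G"
    then obtain x where x: "x \<in> arcs G" "p = ?g x"
      by blast
    have "tail G x \<rightarrow>\<^bsub>G\<^esub> head G x"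
      using x(1) by (auto simp: arcs_ends_conv)
    then have "f (head G x) = Suc (f (tail G x)) mod n \<or> f (tail G x) = Suc (f (head G x)) mod n"
      using adj x(1) by simp
    moreover have "f (tail G x) \<in> {..<n}" "f (head G x) \<in> {..<n}"
      unfolding img[symmetric] using x(1) by simp_all
    ultimately show "p \<in> arcs (cycle_graph n)"
      by (simp add: cycle_graph_def x(2))
  next
    fix p
    assume "p \<in> arcs (cycle_graph n)"
    then obtain i j where p: "p = (i, j)" "i \<in> {..<n}" "j \<in> {..<n}" "j = Suc i mod n \<or> i = Suc j mod n"
      by (auto simp: cycle_graph_def)
    then obtain u v where uv: "u \<in> verts G" "v \<in> verts G" "i = f u" "j = f v"
      unfolding img[symmetric] by blast
    then have "u \<rightarrow>\<^bsub>G\<^esub> v"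
      using adj[OF uv(1,2)] p(4) unfolding uv(3,4) by blast
    then obtain x where "x \<in> arcs G" "tail G x = u" "head G x = v"
      by (rule reachableE)
    then show "p \<in> ?g ` arcs G"
      using p(1) uv(3,4) by (intro image_eqI[of _ _ x]) simp_all
  qed
  then have "cycle_graph n = app_iso h G"
    by (simp add: app_iso_def h_def img cycle_graph_def)
  ultimately show ?thesis
    unfolding digraph_iso_def by blast
qed

lemma (in graph) digraph_iso_pentagon:
  assumes verts: "verts G = {a, b, c, d, e}" and dist: "distinct [a, b, c, d, e]"
    and nb: "neighborhood G a = {e, b}" "neighborhood G b = {a, c}" "neighborhood G c = {b, d}"
      "neighborhood G d = {c, e}" "neighborhood G e = {d, a}"
  shows "digraph_iso G (cycle_graph 5)"
proof -
  define f :: "'a \<Rightarrow> nat" where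
    "f v = (if v = a then 0 else if v = b then 1 else if v = c then 2 else if v = d then 3 else 4)" for v
  have f: "f a = 0" "f b = 1" "f c = 2" "f d = 3" "f e = 4"
    using dist by (auto simp: f_def)
  show ?thesis
  proof (rule digraph_iso_cycle_graphI)
    show "inj_on f (verts G)"
      unfolding verts by (simp add: f inj_on_def)
    show "f ` verts G = {..<5}"
      unfolding verts by (auto simp: f)
    have adj: "u \<rightarrow>\<^bsub>G\<^esub> v \<longleftrightarrow> v \<in> neighborhood G u" for u v
      by (simp add: neighborhood_def)
    show "u \<rightarrow>\<^bsub>G\<^esub> v \<longleftrightarrow> f v = Suc (f u) mod 5 \<or> f u = Suc (f v) mod 5"
      if "u \<in> verts G" "v \<in> verts G" for u v
    proof -
      have "v = a \<or> v = b \<or> v = c \<or> v = d \<or> v = e" "u = a \<or> u = b \<or> u = c \<or> u = d \<or> u = e"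
        using that verts by auto
      moreover have "distinct [e, d, c, b, a]"
        using dist by auto
      ultimately show ?thesis
        unfolding adj using dist by (elim disjE; simp add: f nb)
    qed
  qed
qed

text \<open>Used to thin infinite lists, since \<open>admissible\<close> measures lists by
  \<open>card\<close>.\<close>

lemma ex_finite_subset_card_ge:
  assumes "infinite A \<or> n \<le> card A"
  shows "\<exists>B\<subseteq>A. finite B \<and> n \<le> card B"
proof (cases "finite A")
  case False
  then show ?thesis
    using infinite_arbitrarily_large[of A n] by blast
qed (use assms in blast)

theorem theorem6:
  fixes G :: "('a, 'b) pre_digraph"
  assumes "graph G"
    and "Digraph_Component.connected G"
    and "max_degree G \<le> 3"
    and "\<not> digraph_iso G (cycle_graph 5)"
  shows "proper_conflict_free_degree_choosable TYPE('c) G 2"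
proof -
  interpret graph G
    by fact
  show ?thesis
    unfolding proper_conflict_free_degree_choosable_def proper_conflict_free_choosable_def
  proof (intro allI impI)
    fix L :: "'a \<Rightarrow> 'c set"
    assume "list_assignment G (\<lambda>v. out_degree G v + 2) L"
    then have "\<forall>v\<in>verts G. \<exists>B\<subseteq>L v. finite B \<and> out_degree G v + 2 \<le> card B"
      unfolding list_assignment_def using ex_finite_subset_card_ge by blast
    then obtain L0 where
      L0: "\<And>v. v \<in> verts G \<Longrightarrow> L0 v \<subseteq> L v \<and> finite (L0 v) \<and> out_degree G v + 2 \<le> card (L0 v)"
      by metis
    interpret list_graph "\<lambda>u v. u \<rightarrow>\<^bsub>G\<^esub> v" L0
    proof
      show "v \<rightarrow>\<^bsub>G\<^esub> u" if "u \<rightarrow>\<^bsub>G\<^esub> v" for u v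
        using that by (rule arcs_ends_symmetric[OF sym_arcs])
      show "\<not> v \<rightarrow>\<^bsub>G\<^esub> v" for v
        using adj_not_same by blast
    qed
    have nb: "nb (verts G) v = neighborhood G v" for v
      by (auto simp: nb_def neighborhood_def adj_in_verts)
    have "out_degree G v \<le> 3" if "v \<in> verts G" for v
      using Max_ge[OF finite_imageI[OF finite_verts] imageI[OF that], of "out_degree G"] assms(3)
      unfolding max_degree_def by linarith
    then have ad: "admissible (verts G)"
      using L0 by (simp add: admissible_def nb out_degree_eq_card_neighborhood)
    have "\<nexists>a b c d e. bad_pentagon (verts G) a b c d e"
    proof
      assume "\<exists>a b c d e. bad_pentagon (verts G) a b c d e"
      then obtain a b c d e where "bad_pentagon (verts G) a b c d e"
        by blast
      then have dist: "distinct [a, b, c, d, e]"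
        and nbs: "neighborhood G a = {e, b}" "neighborhood G b = {a, c}" "neighborhood G c = {b, d}"
          "neighborhood G d = {c, e}" "neighborhood G e = {d, a}"
        by (simp_all add: bad_pentagon_def nb)
      \<comment> \<open>No edge leaves a bad pentagon, so by connectedness it is all of
        \<open>G\<close>, which would then be a 5-cycle.\<close>
      have "verts G = {a, b, c, d, e}"
      proof (rule connected_closed[OF assms(2)])
        have "{e, b} \<subseteq> verts G" "{a, c} \<subseteq> verts G" "{c, e} \<subseteq> verts G" "{b, d} \<subseteq> verts G"
          unfolding nbs[symmetric] nb[symmetric] by (rule nb_subset)+
        then show "{a, b, c, d, e} \<subseteq> verts G"
          by blast
        show "neighborhood G v \<subseteq> {a, b, c, d, e}" if "v \<in> {a, b, c, d, e}" for v
          using that by (elim insertE emptyE; simp add: nbs)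
      qed simp
      then show False
        using digraph_iso_pentagon[OF _ dist nbs] assms(4) by blast
    qed
    from ex_good[OF ad this] obtain \<phi> where \<phi>: "good (verts G) {} \<phi>"
      by blast
    have "proper_conflict_free_coloring G L \<phi>"
      unfolding proper_conflict_free_coloring_def
    proof (intro conjI ballI impI)
      fix v
      assume v: "v \<in> verts G"
      have "\<phi> v \<in> L0 v"
        using \<phi> v by (simp add: good_def)
      then show "\<phi> v \<in> L v"
        using L0[OF v] by blast
      show "\<exists>c. \<exists>!u. u \<in> neighborhood G v \<and> \<phi> u = c" if "neighborhood G v \<noteq> {}"
      proof -
        have "uniq \<phi> (neighborhood G v)"
          using \<phi> v that by (simp add: good_def nb)
        then obtain u where "u \<in> neighborhood G v"
          "\<And>w. w \<in> neighborhood G v \<Longrightarrow> \<phi> w = \<phi> u \<Longrightarrow> w = u"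
          by (auto simp: uniq_def)
        then show ?thesis
          by (intro exI[of _ "\<phi> u"] ex1I[of _ u]) auto
      qed
      show "\<phi> v \<noteq> \<phi> w" if "w \<in> verts G" "v \<rightarrow>\<^bsub>G\<^esub> w" for w
      proof -
        have "w \<in> nb (verts G) v"
          using that by (simp add: nb_def)
        then have "\<phi> w \<noteq> \<phi> v"
          using \<phi> v unfolding good_def by blast
        then show ?thesis
          by simp
      qed
    qed
    then show "\<exists>\<phi>. proper_conflict_free_coloring G L \<phi>"
      by blast
  qed
qed

end
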